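(* There is an absolute constant $C>0$ such that for every integer $d\ge 2$, every $\mathbf{r}\in\mathbb{R}^d$, every diagonal matrix $\mathbf{D}\in\mathbb{R}^{d\times d}$ with diagonal entries in $\{+1,-1\}$, and every integer $1\le k\le d$, the $k$-bit Circulant Binary Embedding (CBE) on $\mathbb{R}^d$ determined by $\mathbf{r}$ and $\mathbf{D}$ satisfies the following. (i) Space complexity $\mathcal{O}(d)$: the embedding can be stored using at most $Cd$ numbers. (ii) Time complexity $\mathcal{O}(d\log d)$: there is an algorithm which, from this stored representation and any input $\mathbf{x}\in\mathbb{R}^d$, computes the $k$-bit CBE code of $\mathbf{x}$ using at most $C\,d\log d$ elementary operations.
   Context: For $\mathbf{r}=(r_0,r_1,\dots,r_{d-1})^T\in\mathbb{R}^d$, the circulant matrix $\operatorname{circ}(\mathbf{r})\in\mathbb{R}^{d\times d}$ is the matrix whose $(i,j)$ entry is $r_{(i-j)\bmod d}$, for $0\le i,j\le d-1$ (so its first column is $\mathbf{r}$ and each subsequent column is the cyclic downward shift of the previous one). Let $\mathbf{D}$ be a diagonal $d\times d$ matrix with diagonal entries in $\{+1,-1\}$ (in the method these are drawn as independent random signs, each $\pm1$ with probability $1/2$, and then fixed). Put $\mathbf{R}=\operatorname{circ}(\mathbf{r})$. The $d$-bit Circulant Binary Embedding (CBE) of $\mathbf{x}\in\mathbb{R}^d$ is $$h(\mathbf{x})=\operatorname{sign}(\mathbf{R}\mathbf{D}\mathbf{x})\in\{+1,-1\}^d,$$ where $\operatorname{sign}$ acts elementwise, with $\operatorname{sign}(t)=1$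 if $t\ge 0$ and $\operatorname{sign}(t)=-1$ if $t<0$. For $k<d$, the $k$-bit CBE of $\mathbf{x}$ consists of the first $k$ entries of $h(\mathbf{x})$. Cost model: an elementary operation is an addition, subtraction, multiplication or division of two complex numbers, or the evaluation of the sign of a real number; all of these are exact and of unit cost. Fixed complex constants depending only on $d$ (such as roots of unity) may be used by the algorithm. Storage is counted as the number of real or complex numbers stored. *)

theory Defs
  imports
    Complex_Main
    "HOL-Library.Monad_Syntax"
    "Jordan_Normal_Form.Matrix"
begin

text \<open>The difference \<open>i - j\<close> is taken in \<^typ>\<open>int\<close>, where \<open>mod\<close> by a positive
  number is nonnegative.\<close>

definition circ :: "'a vec \<Rightarrow> 'a mat" where
  "circ r = mat (dim_vec r) (dim_vec r)
     (\<lambda>(i, j). r $ nat ((int i - int j) mod int (dim_vec r)))"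

text \<open>Unlike \<^const>\<open>sgn\<close>, this sign takes the value \<open>1\<close> at \<open>0\<close>.\<close>

definition bin_sign :: "real \<Rightarrow> real" where
  "bin_sign t = (if t \<ge> 0 then 1 else - 1)"

definition sign_diagonal :: "nat \<Rightarrow> real mat \<Rightarrow> bool" where
  "sign_diagonal d D \<longleftrightarrow>
     D \<in> carrier_mat d d \<and> diagonal_mat D \<and> (\<forall>i<d. D $$ (i, i) \<in> {1, - 1})"

definition cbe :: "real vec \<Rightarrow> real mat \<Rightarrow> real vec \<Rightarrow> real vec" where
  "cbe r D x = map_vec bin_sign (circ r * D *\<^sub>v x)"

definition cbe_bits :: "nat \<Rightarrow> real vec \<Rightarrow> real mat \<Rightarrow> real vec \<Rightarrow> real vec" where
  "cbe_bits k r D x = vec_first (cbe r D x) k"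

text \<open>
  Algorithms are straight-line programs over the complex numbers. An operand is
  an entry of a table of fixed constants, of the stored representation or of
  the input, or else the result of an earlier instruction. Reading an operand is
  free, and every instruction costs one unit. A program contains no numbers
  itself: it refers to all of them by position.

  An execution is undefined (\<^const>\<open>None\<close>) if an operand does not exist, if a
  divisor is zero, or if the sign of a non-real number is requested.
\<close>

datatype operand = Const nat | Stored nat | Input nat | Result nat

datatype instruction =
    Add operand operand
  | Sub operand operand
  | Mul operand operand
  | Div operand operand
  | Sign operand

datatype program = Program (instructions: "instruction list") (outputs: "operand list")

definition lookup :: "'a list \<Rightarrow> nat \<Rightarrow> 'a option" where
  "lookup xs i = (if i < length xs then Some (xs ! i) else None)"

text \<open>In the functions below, \<open>cs\<close>, \<open>ss\<close>, \<open>xs\<close> and \<open>vs\<close> are the constants,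
  the stored numbers, the input and the results computed so far, in order of
  computation.\<close>

fun fetch :: "complex list \<Rightarrow> complex list \<Rightarrow> complex list \<Rightarrow> complex list
    \<Rightarrow> operand \<Rightarrow> complex option" where
  "fetch cs ss xs vs (Const i) = lookup cs i"
| "fetch cs ss xs vs (Stored i) = lookup ss i"
| "fetch cs ss xs vs (Input i) = lookup xs i"
| "fetch cs ss xs vs (Result i) = lookup vs i"

fun step :: "(operand \<Rightarrow> complex option) \<Rightarrow> instruction \<Rightarrow> complex option" where
  "step f (Add a b) = do { u \<leftarrow> f a; v \<leftarrow> f b; Some (u + v) }"
| "step f (Sub a b) = do { u \<leftarrow> f a; v \<leftarrow> f b; Some (u - v) }"
| "step f (Mul a b) = do { u \<leftarrow> f a; v \<leftarrow> f b; Some (u * v) }"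
| "step f (Div a b) = do { u \<leftarrow> f a; v \<leftarrow> f b; if v = 0 then None else Some (u / v) }"
| "step f (Sign a) =
     do { u \<leftarrow> f a; if u \<in> \<real> then Some (complex_of_real (bin_sign (Re u))) else None }"

fun exec :: "complex list \<Rightarrow> complex list \<Rightarrow> complex list
    \<Rightarrow> instruction list \<Rightarrow> complex list \<Rightarrow> complex list option" where
  "exec cs ss xs [] vs = Some vs"
| "exec cs ss xs (i # is) vs =
     do { v \<leftarrow> step (fetch cs ss xs vs) i; exec cs ss xs is (vs @ [v]) }"

definition run :: "complex list \<Rightarrow> program \<Rightarrow> complex list \<Rightarrow> complex list
    \<Rightarrow> complex list option" where
  "run cs P ss xs =
     do { vs \<leftarrow> exec cs ss xs (instructions P) [];
          those (map (fetch cs ss xs vs) (outputs P)) }"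

definition cost :: "program \<Rightarrow> nat" where
  "cost P = length (instructions P)"

definition complex_list :: "real vec \<Rightarrow> complex list" where
  "complex_list v = map complex_of_real (list_of_vec v)"

end

theory Submission
  imports Defs
begin

text \<open>
  Over a window of \<open>N \<ge> 2 d\<close> indices the product with a \<open>d \<times> d\<close> circulant matrix becomes a
  cyclic convolution of length \<open>N\<close>, and \<open>N\<close> may be taken to be a power of two not exceeding \<open>4 d\<close>.
  By the convolution theorem it is obtained from two discrete Fourier transforms of length \<open>N\<close>
  and one pointwise product with the transform of the padded \<open>r\<close>, which is stored along with the
  diagonal of \<open>D\<close>. Each transform is evaluated by the radix-2 recursion with
  \<open>2 N log N\<close> operations.
\<close>

section \<open>Straight-line complexity\<close>

lemma exec_append:
  "exec cs ss xs (is @ js) vs = Option.bind (exec cs ss xs is vs) (exec cs ss xs js)"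
  by (induction "is" arbitrary: vs) (auto split: bind_splits)

lemma exec_extends: "exec cs ss xs is vs = Some ws \<Longrightarrow> \<exists>us. ws = vs @ us"
  by (induction "is" arbitrary: vs) (fastforce split: bind_splits)+

lemma length_exec: "exec cs ss xs is vs = Some ws \<Longrightarrow> length ws = length vs + length is"
  by (induction "is" arbitrary: vs) (fastforce split: bind_splits)+

text \<open>Results are addressed by absolute position, and new ones are appended at the end, so old
  references stay valid.\<close>

lemma fetch_extends: "fetch cs ss xs vs a = Some u \<Longrightarrow> fetch cs ss xs (vs @ us) a = Some u"
  by (cases a) (auto simp: lookup_def nth_append split: if_splits)

text \<open>The stored numbers and the input depend on a parameter \<open>e\<close>; a quantity to be computed is a
  function of \<open>e\<close>, while the program has to be the same for all \<open>e\<close>.\<close>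

locale straight_line =
  fixes cs :: "complex list" and ss xs :: "'e \<Rightarrow> complex list"
begin

definition executable :: "instruction list \<Rightarrow> bool" where
  "executable is \<longleftrightarrow> (\<forall>e. exec cs (ss e) (xs e) is [] \<noteq> None)"

text \<open>The operand \<open>a\<close> is chosen before \<open>e\<close>: one fixed reference must
  yield \<open>f e\<close> for every parameter, as a program cannot look at the data when choosing
  its operands.\<close>

definition available :: "instruction list \<Rightarrow> ('e \<Rightarrow> complex) \<Rightarrow> bool" where
  "available is f \<longleftrightarrow>
     (\<exists>a. \<forall>e. \<exists>vs. exec cs (ss e) (xs e) is [] = Some vs \<and>
       fetch cs (ss e) (xs e) vs a = Some (f e))"

text \<open>The prefix \<open>is\<close> is arbitrary, and \<open>js\<close> may depend on it
  because result positions shift with the length of the prefix. This makes costs additive under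
  composition.\<close>

definition computes :: "('e \<Rightarrow> complex) set \<Rightarrow> nat \<Rightarrow> ('e \<Rightarrow> complex) set \<Rightarrow> bool" where
  "computes S n T \<longleftrightarrow>
     (\<forall>is. executable is \<and> (\<forall>f\<in>S. available is f) \<longrightarrow>
       (\<exists>js. length js \<le> n \<and> executable (is @ js) \<and> (\<forall>f\<in>T. available (is @ js) f)))"

lemma available_append:
  assumes "available is f" "executable (is @ js)"
  shows "available (is @ js) f"
proof -
  obtain a where a: "\<exists>vs. exec cs (ss e) (xs e) is [] = Some vs \<and>
       fetch cs (ss e) (xs e) vs a = Some (f e)" for e
    using assms(1) unfolding available_def by blast
  have "\<exists>vs. exec cs (ss e) (xs e) (is @ js) [] = Some vs \<and>
       fetch cs (ss e) (xs e) vs a = Some (f e)" for e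
  proof -
    obtain vs where vs: "exec cs (ss e) (xs e) is [] = Some vs"
      "fetch cs (ss e) (xs e) vs a = Some (f e)" using a by blast
    obtain ws where ws: "exec cs (ss e) (xs e) (is @ js) [] = Some ws"
      using assms(2) unfolding executable_def by blast
    then have "exec cs (ss e) (xs e) js vs = Some ws"
      using vs by (simp add: exec_append)
    then obtain us where "ws = vs @ us" using exec_extends by blast
    with ws vs fetch_extends show ?thesis by blast
  qed
  then show ?thesis unfolding available_def by blast
qed

lemma available_step:
  assumes "executable is"
    and "\<And>e vs. exec cs (ss e) (xs e) is [] = Some vs \<Longrightarrow>
      step (fetch cs (ss e) (xs e) vs) i = Some (f e)"
  shows "executable (is @ [i]) \<and> available (is @ [i]) f"
proof -
  \<comment> \<open>The new value sits right after the \<open>length is\<close> earlier results,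
    hence at a position independent of \<open>e\<close>.\<close>
  have "\<exists>vs. exec cs (ss e) (xs e) (is @ [i]) [] = Some vs \<and>
       fetch cs (ss e) (xs e) vs (Result (length is)) = Some (f e)" for e
  proof -
    obtain vs where vs: "exec cs (ss e) (xs e) is [] = Some vs"
      using assms(1) unfolding executable_def by blast
    with assms(2)[OF vs] length_exec[OF vs] show ?thesis
      by (simp add: exec_append lookup_def nth_append)
  qed
  then show ?thesis unfolding executable_def available_def by (metis option.distinct(1))
qed

section \<open>Composition rules for costs\<close>

lemma computes_refl: "T \<subseteq> S \<Longrightarrow> computes S 0 T"
  unfolding computes_def by (metis append_Nil2 le_refl list.size(3) subsetD)

lemma computes_mono:
  "computes S n T \<Longrightarrow> S \<subseteq> S' \<Longrightarrow> n \<le> n' \<Longrightarrow> T' \<subseteq> T \<Longrightarrow> computes S' n' T'"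
  unfolding computes_def by (meson le_trans subsetD)

text \<open>Appending instructions destroys nothing, so the intermediate values \<open>T\<close>
  survive the second stage. Keeping them in the conclusion lets both sequential and parallel
  composition follow by monotonicity.\<close>

lemma computes_Un_trans:
  assumes "computes S m T" "computes (S \<union> T) n U"
  shows "computes S (m + n) (T \<union> U)"
  unfolding computes_def
proof (intro allI impI)
  fix "is"
  assume *: "executable is \<and> (\<forall>f\<in>S. available is f)"
  then obtain js where js: "length js \<le> m" "executable (is @ js)"
    "\<forall>f\<in>T. available (is @ js) f"
    using assms(1) unfolding computes_def by blast
  then have "\<forall>f\<in>S \<union> T. available (is @ js) f"
    using * available_append by blast
  then obtain ks where ks: "length ks \<le> n" "executable ((is @ js) @ ks)"
    "\<forall>f\<in>U. available ((is @ js) @ ks) f"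
    using assms(2) js(2) unfolding computes_def by blast
  then have "\<forall>f\<in>T \<union> U. available ((is @ js) @ ks) f"
    using js available_append by blast
  then show "\<exists>js. length js \<le> m + n \<and> executable (is @ js) \<and>
      (\<forall>f\<in>T \<union> U. available (is @ js) f)"
    using ks js by (intro exI[of _ "js @ ks"]) auto
qed

lemma computes_trans: "computes S m T \<Longrightarrow> computes (S \<union> T) n U \<Longrightarrow> computes S (m + n) U"
  by (rule computes_mono[OF computes_Un_trans]) auto

lemma computes_Un: "computes S m T \<Longrightarrow> computes S n U \<Longrightarrow> computes S (m + n) (T \<union> U)"
  by (rule computes_Un_trans) (auto intro: computes_mono)

lemma computes_family:
  assumes "\<And>i. i < n \<Longrightarrow> computes S c {F i}"
  shows "computes S (n * c) (F ` {..<n})"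
  using assms
proof (induction n)
  case 0
  show ?case by (simp add: computes_refl)
next
  case (Suc n)
  have "computes S (n * c + c) (F ` {..<n} \<union> {F n})"
    by (intro computes_Un Suc.IH Suc.prems) auto
  then show ?case by (simp add: lessThan_Suc add.commute)
qed

text \<open>The instruction \<open>i\<close> may depend on the program \<open>is\<close>, which
  fixes the positions of the operands, but not on \<open>e\<close>.\<close>

lemma computes_instruction:
  assumes "\<And>is. executable is \<Longrightarrow> \<forall>g\<in>S. available is g \<Longrightarrow>
    \<exists>i. \<forall>e vs. exec cs (ss e) (xs e) is [] = Some vs \<longrightarrow>
      step (fetch cs (ss e) (xs e) vs) i = Some (f e)"
  shows "computes S 1 {f}"
  unfolding computes_def
proof (intro allI impI)
  fix "is"
  assume *: "executable is \<and> (\<forall>g\<in>S. available is g)"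
  then obtain i where "\<And>e vs. exec cs (ss e) (xs e) is [] = Some vs \<Longrightarrow>
      step (fetch cs (ss e) (xs e) vs) i = Some (f e)"
    using assms by blast
  with * available_step have "executable (is @ [i]) \<and> available (is @ [i]) f" by blast
  then show "\<exists>js. length js \<le> 1 \<and> executable (is @ js) \<and> (\<forall>g\<in>{f}. available (is @ js) g)"
    by (intro exI[of _ "[i]"]) simp
qed

text \<open>Execution is deterministic, so the existential over \<open>vs\<close> in
  \<open>available\<close> can be traded for a universal one.\<close>

lemma available_operand:
  assumes "available is f"
  obtains a where "\<And>e vs. exec cs (ss e) (xs e) is [] = Some vs \<Longrightarrow>
    fetch cs (ss e) (xs e) vs a = Some (f e)"
  using assms unfolding available_def by (metis option.inject)

section \<open>Single instructions\<close>

lemma computes_add: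
  assumes "f \<in> S" "g \<in> S"
  shows "computes S 1 {\<lambda>e. f e + g e}"
proof (rule computes_instruction)
  fix "is"
  assume *: "\<forall>g\<in>S. available is g"
  obtain a where a: "\<And>e vs. exec cs (ss e) (xs e) is [] = Some vs \<Longrightarrow>
    fetch cs (ss e) (xs e) vs a = Some (f e)"
    using * assms(1) available_operand by metis
  obtain b where b: "\<And>e vs. exec cs (ss e) (xs e) is [] = Some vs \<Longrightarrow>
    fetch cs (ss e) (xs e) vs b = Some (g e)"
    using * assms(2) available_operand by metis
  show "\<exists>i. \<forall>e vs. exec cs (ss e) (xs e) is [] = Some vs \<longrightarrow>
      step (fetch cs (ss e) (xs e) vs) i = Some (f e + g e)"
    by (intro exI[of _ "Add a b"]) (simp add: a b)
qed

lemma computes_mult: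
  assumes "f \<in> S" "g \<in> S"
  shows "computes S 1 {\<lambda>e. f e * g e}"
proof (rule computes_instruction)
  fix "is"
  assume *: "\<forall>g\<in>S. available is g"
  obtain a where a: "\<And>e vs. exec cs (ss e) (xs e) is [] = Some vs \<Longrightarrow>
    fetch cs (ss e) (xs e) vs a = Some (f e)"
    using * assms(1) available_operand by metis
  obtain b where b: "\<And>e vs. exec cs (ss e) (xs e) is [] = Some vs \<Longrightarrow>
    fetch cs (ss e) (xs e) vs b = Some (g e)"
    using * assms(2) available_operand by metis
  show "\<exists>i. \<forall>e vs. exec cs (ss e) (xs e) is [] = Some vs \<longrightarrow>
      step (fetch cs (ss e) (xs e) vs) i = Some (f e * g e)"
    by (intro exI[of _ "Mul a b"]) (simp add: a b)
qed

text \<open>Writing the argument as \<open>complex_of_real (g e)\<close> guarantees realness,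
  without which \<open>Sign\<close> would be undefined.\<close>

lemma computes_sign:
  assumes "(\<lambda>e. complex_of_real (g e)) \<in> S"
  shows "computes S 1 {\<lambda>e. complex_of_real (bin_sign (g e))}"
proof (rule computes_instruction)
  fix "is"
  assume *: "\<forall>g\<in>S. available is g"
  obtain a where a: "\<And>e vs. exec cs (ss e) (xs e) is [] = Some vs \<Longrightarrow>
    fetch cs (ss e) (xs e) vs a = Some (complex_of_real (g e))"
    using * assms available_operand by metis
  show "\<exists>i. \<forall>e vs. exec cs (ss e) (xs e) is [] = Some vs \<longrightarrow>
      step (fetch cs (ss e) (xs e) vs) i = Some (complex_of_real (bin_sign (g e)))"
    by (intro exI[of _ "Sign a"]) (simp add: a)
qed

section \<open>From cost statements to actual programs\<close>

lemma executable_Nil: "executable []"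
  by (simp add: executable_def)

lemma available_Const: "i < length cs \<Longrightarrow> available [] (\<lambda>_. cs ! i)"
  unfolding available_def by (intro exI[of _ "Const i"]) (simp add: lookup_def)

lemma available_Stored: "(\<And>e. i < length (ss e)) \<Longrightarrow> available [] (\<lambda>e. ss e ! i)"
  unfolding available_def by (intro exI[of _ "Stored i"]) (simp add: lookup_def)

lemma available_Input: "(\<And>e. i < length (xs e)) \<Longrightarrow> available [] (\<lambda>e. xs e ! i)"
  unfolding available_def by (intro exI[of _ "Input i"]) (simp add: lookup_def)

text \<open>\<open>Collect (available [])\<close> consists of what can be read before any
  instruction: constants, stored numbers and input. The instructions obtained from the empty prefix
  form the program, and the operands of the \<open>F i\<close> are its outputs.\<close>

lemma computes_program:
  assumes "computes (Collect (available [])) n (F ` {..<k})"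
  shows "\<exists>P. cost P \<le> n \<and> (\<forall>e. run cs P (ss e) (xs e) = Some (map (\<lambda>i. F i e) [0..<k]))"
proof -
  obtain js where js: "length js \<le> n" "executable js" "\<forall>f\<in>F ` {..<k}. available js f"
    using assms executable_Nil unfolding computes_def by fastforce
  have "\<forall>i. \<exists>a. i < k \<longrightarrow> (\<forall>e vs. exec cs (ss e) (xs e) js [] = Some vs \<longrightarrow>
      fetch cs (ss e) (xs e) vs a = Some (F i e))"
    using js(3) available_operand by (metis imageI lessThan_iff)
  then obtain a where a: "\<And>i e vs. i < k \<Longrightarrow> exec cs (ss e) (xs e) js [] = Some vs \<Longrightarrow>
      fetch cs (ss e) (xs e) vs (a i) = Some (F i e)"
    by metis
  have "run cs (Program js (map a [0..<k])) (ss e) (xs e) = Some (map (\<lambda>i. F i e) [0..<k])" for e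
  proof -
    obtain vs where vs: "exec cs (ss e) (xs e) js [] = Some vs"
      using js(2) unfolding executable_def by blast
    have "map (fetch cs (ss e) (xs e) vs) (map a [0..<k]) = map Some (map (\<lambda>i. F i e) [0..<k])"
      using a[OF _ vs] by simp
    moreover have "those (map Some ys) = Some ys" for ys :: "complex list"
      by (induction ys) auto
    ultimately show ?thesis using vs by (simp add: run_def del: map_map)
  qed
  with js(1) show ?thesis by (intro exI[of _ "Program js (map a [0..<k])"]) (simp add: cost_def)
qed

end

section \<open>The discrete Fourier transform\<close>

text \<open>The base \<open>w\<close> is a parameter so that the inverse transform (base
  \<open>inverse w\<close>) and the half-length transforms of the recursion (base
  \<open>w^2\<close>) are instances.\<close>

definition dft :: "'a::comm_semiring_1 \<Rightarrow> nat \<Rightarrow> (nat \<Rightarrow> 'a) \<Rightarrow> nat \<Rightarrow> 'a" where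
  "dft w N f k = (\<Sum>j<N. f j * w ^ (j * k))"

lemma power_mod_order:
  fixes w :: "'a::monoid_mult"
  assumes "w ^ N = 1"
  shows "w ^ (a mod N) = w ^ a"
proof -
  have "w ^ a = w ^ (N * (a div N) + a mod N)" by simp
  also have "\<dots> = w ^ (a mod N)" using assms by (simp only: power_add power_mult) simp
  finally show ?thesis by simp
qed

text \<open>Needed for the recursion, where a half-length transform is computed only for indices
  below its length but read at larger ones.\<close>

lemma dft_mod:
  assumes "w ^ N = 1"
  shows "dft w N f (k mod N) = dft w N f k"
proof -
  have "w ^ (j * (k mod N)) = w ^ (j * k)" for j
    by (metis power_mod_order[OF assms] mod_mult_right_eq)
  then show ?thesis by (simp add: dft_def)
qed

text \<open>Radix-2 splitting: separate even and odd \<open>j\<close>; the odd terms share the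
  factor \<open>w ^ k\<close>.\<close>

lemma dft_double:
  "dft w (2 * N) f k =
     dft (w\<^sup>2) N (\<lambda>j. f (2 * j)) k + w ^ k * dft (w\<^sup>2) N (\<lambda>j. f (2 * j + 1)) k"
proof -
  have "dft w (2 * N) f k =
      (\<Sum>j<N. f (2 * j) * w ^ (2 * j * k)) + (\<Sum>j<N. f (2 * j + 1) * w ^ ((2 * j + 1) * k))"
    unfolding dft_def by (induction N) (simp_all add: algebra_simps)
  also have "(\<Sum>j<N. f (2 * j + 1) * w ^ ((2 * j + 1) * k)) =
      w ^ k * (\<Sum>j<N. f (2 * j + 1) * (w\<^sup>2) ^ (j * k))"
    unfolding sum_distrib_left
    by (intro sum.cong refl) (simp add: algebra_simps power_add flip: power_mult)
  finally show ?thesis by (simp add: dft_def mult.assoc flip: power_mult)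
qed

lemma sum_powers_root_of_unity:
  fixes z :: "'a::field"
  assumes "z ^ N = 1"
  shows "(\<Sum>k<N. z ^ k) = (if z = 1 then of_nat N else 0)"
  using assms by (simp add: geometric_sum)

text \<open>After expanding both transforms, summing over \<open>k\<close> first gives, by
  orthogonality of the powers of \<open>w\<close>, the value \<open>N\<close> when
  \<open>t + j\<close> is congruent to \<open>i\<close> modulo \<open>N\<close> and 0 otherwise. The
  factor 1/N sits on the transform of \<open>c\<close>, so that it can be precomputed with
  it.\<close>

lemma dft_convolution:
  fixes w :: "'a::field_char_0"
  assumes N: "w ^ N = 1" "inj_on (\<lambda>k. w ^ k) {..<N}" and i: "i < N"
  shows "dft (inverse w) N (\<lambda>k. dft w N c k / of_nat N * dft w N u k) i =
    (\<Sum>j<N. c ((i + N - j) mod N) * u j)"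
proof -
  have w0: "w \<noteq> 0" using N(1) i by (auto simp: power_0_left)
  have inner: "(\<Sum>k<N. (w ^ (t + j) * inverse w ^ i) ^ k) =
      (if t = (i + N - j) mod N then of_nat N else 0)" if "t < N" "j < N" for t j
  proof -
    let ?z = "w ^ (t + j) * inverse w ^ i"
    have "?z ^ N = (w ^ N) ^ (t + j) * inverse ((w ^ N) ^ i)"
      by (simp add: power_mult_distrib power_inverse mult.commute flip: power_mult)
    then have "?z ^ N = 1" using N(1) by simp
    moreover have "?z = 1 \<longleftrightarrow> w ^ (t + j) = w ^ i"
      using w0 by (simp add: power_inverse field_simps)
    \<comment> \<open>Injectivity below \<open>N\<close> says that \<open>w\<close> is primitive, so
      equal powers have congruent exponents.\<close>
    moreover have "w ^ (t + j) = w ^ i \<longleftrightarrow> (t + j) mod N = i"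
      using N i by (metis (no_types, lifting) inj_onD lessThan_iff mod_less_divisor
          not_less0 power_mod_order gr_zeroI)
    moreover have "(t + j) mod N = i \<longleftrightarrow> t = (i + N - j) mod N"
    proof (cases "j \<le> i")
      case True
      then show ?thesis using that i by (auto simp: mod_if)
    next
      case False
      then show ?thesis using that i by (auto simp: mod_if)
    qed
    ultimately show ?thesis using sum_powers_root_of_unity[of ?z N] by simp
  qed
  have "dft (inverse w) N (\<lambda>k. dft w N c k / of_nat N * dft w N u k) i =
      (\<Sum>k<N. \<Sum>t<N. \<Sum>j<N. c t * u j / of_nat N * (w ^ (t + j) * inverse w ^ i) ^ k)"
    unfolding dft_def
    by (intro sum.cong refl, subst times_divide_eq_left, subst sum_product)
      (simp add: sum_divide_distrib sum_distrib_right sum_distrib_left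
        power_add algebra_simps flip: power_mult)
  \<comment> \<open>The sum over \<open>k\<close> is moved innermost so that \<open>inner\<close>
    applies.\<close>
  also have "\<dots> = (\<Sum>j<N. \<Sum>t<N. \<Sum>k<N. c t * u j / of_nat N * (w ^ (t + j) * inverse w ^ i) ^ k)"
    by (subst sum.swap, subst (2) sum.swap, subst sum.swap) (rule refl)
  also have "\<dots> = (\<Sum>j<N. \<Sum>t<N. if t = (i + N - j) mod N then c t * u j else 0)"
    using i by (intro sum.cong refl) (simp only: inner lessThan_iff flip: sum_distrib_left, simp)
  also have "\<dots> = (\<Sum>j<N. c ((i + N - j) mod N) * u j)"
    using i by simp
  finally show ?thesis .
qed

lemma primitive_root_of_unity_exists:
  assumes "N > 0"
  obtains w :: complex where "w ^ N = 1" "inj_on (\<lambda>k. w ^ k) {..<N}"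
proof
  have eq: "cis (2 * pi / real N) ^ k = cis (2 * pi * real k / real N)" for k
    by (simp add: Complex.DeMoivre algebra_simps)
  show "cis (2 * pi / real N) ^ N = 1" using assms by (simp add: eq)
  show "inj_on (\<lambda>k. cis (2 * pi / real N) ^ k) {..<N}"
    using bij_betw_roots_unity[OF assms] by (simp add: eq bij_betw_def)
qed

text \<open>The cost solves T(0) = 0, T(m+1) = 2 T(m) + 2 * 2^(m+1): two half-length transforms,
  then one multiplication and one addition per output. The powers of \<open>w^2\<close> used in the
  recursion are even powers of \<open>w\<close>, so one table of roots serves all levels.\<close>

lemma (in straight_line) computes_dft:
  assumes "\<And>j. j < 2 ^ m \<Longrightarrow> f j \<in> S"
    and "\<And>j. j < 2 ^ m \<Longrightarrow> (\<lambda>_. w ^ j) \<in> S"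
    and "w ^ (2 ^ m) = 1"
  shows "computes S (2 * m * 2 ^ m) ((\<lambda>k e. dft w (2 ^ m) (\<lambda>j. f j e) k) ` {..<2 ^ m})"
  using assms
proof (induction m arbitrary: w f)
  case 0
  then show ?case by (intro computes_mono[OF computes_refl[OF subset_refl]]) (auto simp: dft_def)
next
  case (Suc m)
  define A where "A = (\<lambda>k e. dft (w\<^sup>2) (2 ^ m) (\<lambda>j. f (2 * j) e) k)"
  define B where "B = (\<lambda>k e. dft (w\<^sup>2) (2 ^ m) (\<lambda>j. f (2 * j + 1) e) k)"
  have roots: "(\<lambda>_. (w\<^sup>2) ^ j) \<in> S" if "j < 2 ^ m" for j
    using Suc.prems(2)[of "2 * j"] that by (simp add: power_mult)
  have order: "(w\<^sup>2) ^ 2 ^ m = 1" using Suc.prems(3) by (simp flip: power_mult)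
  have A: "computes S (2 * m * 2 ^ m) (A ` {..<2 ^ m})"
    unfolding A_def using Suc.prems(1) by (intro Suc.IH roots order) auto
  have B: "computes S (2 * m * 2 ^ m) (B ` {..<2 ^ m})"
    unfolding B_def using Suc.prems(1) by (intro Suc.IH roots order) auto
  let ?S = "S \<union> (A ` {..<2 ^ m} \<union> B ` {..<2 ^ m})"
  have butterfly: "computes ?S 2 {\<lambda>e. dft w (2 ^ Suc m) (\<lambda>j. f j e) k}" if "k < 2 ^ Suc m" for k
  proof -
    \<comment> \<open>Outputs \<open>k\<close> and \<open>k + 2 ^ m\<close> read the same entries of
      \<open>A\<close> and \<open>B\<close>; only the factor \<open>w ^ k\<close> differs.\<close>
    let ?l = "k mod 2 ^ m"
    have "computes ?S 1 {\<lambda>e. w ^ k * B ?l e}"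
      using Suc.prems(2)[OF that] by (intro computes_mult) auto
    then have "computes ?S (1 + 1) {\<lambda>e. A ?l e + w ^ k * B ?l e}"
      by (rule computes_trans[OF _ computes_add]) auto
    moreover have "(\<lambda>e. A ?l e + w ^ k * B ?l e) = (\<lambda>e. dft w (2 ^ Suc m) (\<lambda>j. f j e) k)"
      by (simp add: A_def B_def dft_mod[OF order] dft_double)
    ultimately show ?thesis by (simp add: numeral_2_eq_2)
  qed
  have "computes S ((2 * m * 2 ^ m + 2 * m * 2 ^ m) + 2 ^ Suc m * 2)
      ((\<lambda>k e. dft w (2 ^ Suc m) (\<lambda>j. f j e) k) ` {..<2 ^ Suc m})"
    by (rule computes_trans[OF computes_Un[OF A B] computes_family[OF butterfly]])
  then show ?case by (simp add: algebra_simps)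
qed

section \<open>Circulant products\<close>

lemma circ_diagonal_mult_vec:
  assumes r: "r \<in> carrier_vec d" and D: "sign_diagonal d D" and x: "x \<in> carrier_vec d"
    and i: "i < d"
  shows "(circ r * D *\<^sub>v x) $ i =
    (\<Sum>j<d. r $ nat ((int i - int j) mod int d) * (D $$ (j, j) * x $ j))"
proof -
  have D': "D \<in> carrier_mat d d" "\<And>j l. j < d \<Longrightarrow> l < d \<Longrightarrow> j \<noteq> l \<Longrightarrow> D $$ (j, l) = 0"
    using D by (auto simp: sign_diagonal_def diagonal_mat_def)
  have c: "circ r \<in> carrier_mat d d" using r by (simp add: circ_def)
  have Dx: "(D *\<^sub>v x) $ j = D $$ (j, j) * x $ j" if "j < d" for j
  proof -
    have "(D *\<^sub>v x) $ j = (\<Sum>l<d. D $$ (j, l) * x $ l)"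
      using D' x that by (simp add: scalar_prod_def lessThan_atLeast0)
    also have "\<dots> = (\<Sum>l<d. if l = j then D $$ (j, j) * x $ j else 0)"
      using D'(2) that by (intro sum.cong) auto
    finally show ?thesis using that by simp
  qed
  have "(circ r * D *\<^sub>v x) $ i = (circ r *\<^sub>v (D *\<^sub>v x)) $ i"
    using assoc_mult_mat_vec[OF c D'(1) x] by simp
  also have "\<dots> = (\<Sum>j<d. circ r $$ (i, j) * (D *\<^sub>v x) $ j)"
    using c D' x i by (simp add: scalar_prod_def lessThan_atLeast0)
  also have "\<dots> = (\<Sum>j<d. r $ nat ((int i - int j) mod int d) * (D $$ (j, j) * x $ j))"
    using r i by (intro sum.cong refl) (simp add: Dx circ_def)
  finally show ?thesis .
qed

text \<open>The index \<open>t\<close> of a sequence of period \<open>N\<close> stands for \<open>t\<close> or \<open>t - N\<close>. Positions from \<open>d\<close> to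
  \<open>N - d\<close> are never read, so the truncated subtraction there is harmless.\<close>

definition unroll :: "nat \<Rightarrow> nat \<Rightarrow> (nat \<Rightarrow> 'a) \<Rightarrow> nat \<Rightarrow> 'a" where
  "unroll d N r t = (if t < d then r t else r (t + d - N))"

text \<open>For \<open>j \<le> i\<close> the cyclic index is \<open>i - j\<close>, below
  \<open>d\<close>. Otherwise it is \<open>i + N - j\<close>, which exceeds \<open>d\<close> because
  \<open>2 * d \<le> N\<close>, and \<open>unroll\<close> moves it back to
  \<open>i - j + d\<close>.\<close>

lemma unroll_cyclic_index:
  assumes "2 * d \<le> N" "i < d" "j < d"
  shows "unroll d N r ((i + N - j) mod N) = r (nat ((int i - int j) mod int d))"
proof (cases "j \<le> i")
  case True
  then have "(i + N - j) mod N = i - j" using assms by (simp add: mod_if)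
  moreover have "(int i - int j) mod int d = int (i - j)" using True assms by simp
  ultimately show ?thesis using assms by (simp add: unroll_def)
next
  case False
  then have "(i + N - j) mod N = i + N - j" using assms by simp
  moreover have "(int i - int j) mod int d = (int i - int j + int d) mod int d" by simp
  moreover have "\<dots> = int i - int j + int d" using False assms by (intro mod_pos_pos_trivial) auto
  moreover have "nat (int i - int j + int d) = i + N - j + d - N" using False assms by linarith
  moreover have "\<not> i + N - j < d" using assms by linarith
  ultimately show ?thesis by (simp add: unroll_def)
qed

text \<open>The quantifier order records the dependencies: constants precede \<open>k\<close>, the
  program precedes \<open>r\<close> and \<open>\<delta>\<close>, and the store precedes
  \<open>x\<close>.\<close>

lemma circulant_program_exists:
  fixes d m :: nat
  assumes N: "2 * d \<le> 2 ^ m"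
  shows "\<exists>cs. \<forall>k\<le>d. \<exists>P. cost P \<le> 4 * m * 2 ^ m + 2 ^ m + 2 * d \<and>
    (\<forall>(r :: nat \<Rightarrow> real) \<delta>. \<exists>store. length store = d + 2 ^ m \<and>
      (\<forall>x. run cs P store (map (\<lambda>i. complex_of_real (x i)) [0..<d]) =
        Some (map (\<lambda>i. complex_of_real (bin_sign
          (\<Sum>j<d. r (nat ((int i - int j) mod int d)) * (\<delta> j * x j)))) [0..<k])))"
proof -
  define N :: nat where "N = 2 ^ m"
  have N0: "N > 0" and dN: "2 * d \<le> N" using assms by (simp_all add: N_def)
  obtain w :: complex where w: "w ^ N = 1" "inj_on (\<lambda>k. w ^ k) {..<N}"
    using primitive_root_of_unity_exists[OF N0] .
  \<comment> \<open>The 0 pads the input to length \<open>N\<close>; the two blocks of powers serve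
    the forward and the inverse transform.\<close>
  define cs where "cs = 0 # map (\<lambda>j. w ^ j) [0..<N] @ map (\<lambda>j. inverse w ^ j) [0..<N]"
  \<comment> \<open>The transform of the unrolled \<open>r\<close> is stored already divided by
    \<open>N\<close>, so the program performs no division.\<close>
  define stored where "stored = (\<lambda>(r :: nat \<Rightarrow> real) \<delta> :: nat \<Rightarrow> real.
    map (\<lambda>j. complex_of_real (\<delta> j)) [0..<d] @
    map (\<lambda>k. dft w N (\<lambda>t. complex_of_real (unroll d N r t)) k / of_nat N) [0..<N])"
  \<comment> \<open>The parameter \<open>e\<close> is the triple of \<open>r\<close>,
    \<open>\<delta>\<close> and \<open>x\<close>; the store is built from the first two
    alone.\<close>
  define ss where "ss = (\<lambda>(r, \<delta>, x :: nat \<Rightarrow> real). stored r \<delta>)"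
  define xs where "xs = (\<lambda>(r :: nat \<Rightarrow> real, \<delta> :: nat \<Rightarrow> real, x :: nat \<Rightarrow> real).
    map (\<lambda>i. complex_of_real (x i)) [0..<d])"
  define y where "y = (\<lambda>i (r, \<delta>, x).
    \<Sum>j<d. r (nat ((int i - int j) mod int d)) * (\<delta> j * x j :: real))"
  interpret straight_line cs ss xs .
  let ?S = "Collect (available [])"
  have zero: "(\<lambda>_. 0) \<in> ?S"
    using available_Const[of 0] by (simp add: cs_def)
  have root: "(\<lambda>_. w ^ j) \<in> ?S" if "j < N" for j
    using available_Const[of "Suc j"] that by (simp add: cs_def nth_append)
  have inv_root: "(\<lambda>_. inverse w ^ j) \<in> ?S" if "j < N" for j
    using available_Const[of "Suc (N + j)"] that by (simp add: cs_def nth_append)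
  have diag: "(\<lambda>(r, \<delta>, x). complex_of_real (\<delta> j)) \<in> ?S" if "j < d" for j
  proof -
    have "(\<lambda>e. ss e ! j) = (\<lambda>(r, \<delta>, x). complex_of_real (\<delta> j))"
      using that by (auto simp: ss_def stored_def nth_append)
    then show ?thesis
      using available_Stored[of j] that by (auto simp: ss_def stored_def split: prod.splits)
  qed
  define C where
    "C = (\<lambda>k (r :: nat \<Rightarrow> real, \<delta> :: nat \<Rightarrow> real, x :: nat \<Rightarrow> real).
      dft w N (\<lambda>t. complex_of_real (unroll d N r t)) k / of_nat N)"
  have filter: "C k \<in> ?S" if "k < N" for k
  proof -
    have "(\<lambda>e. ss e ! (d + k)) = C k"
      using that by (auto simp: C_def ss_def stored_def nth_append)
    then show ?thesis
      using available_Stored[of "d + k"] that by (auto simp: ss_def stored_def split: prod.splits)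
  qed
  have inp: "(\<lambda>(r, \<delta>, x). complex_of_real (x j)) \<in> ?S" if "j < d" for j
  proof -
    have "(\<lambda>e. xs e ! j) = (\<lambda>(r, \<delta>, x). complex_of_real (x j))"
      using that by (auto simp: xs_def)
    then show ?thesis
      using available_Input[of j] that by (auto simp: xs_def split: prod.splits)
  qed
  define u where "u = (\<lambda>j (r :: nat \<Rightarrow> real, \<delta>, x). if j < d then complex_of_real (\<delta> j * x j) else 0)"
  have 1: "computes ?S (d * 1) (u ` {..<d})"
  proof (rule computes_family)
    fix j assume j: "j < d"
    have "u j = (\<lambda>e. (case e of (r, \<delta>, x) \<Rightarrow> complex_of_real (\<delta> j)) *
        (case e of (r, \<delta>, x) \<Rightarrow> complex_of_real (x j)))"
      using j by (auto simp: u_def)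
    then show "computes ?S 1 {u j}" using computes_mult[OF diag inp] j by simp
  qed
  have u: "u j \<in> ?S \<union> u ` {..<d}" for j
  proof (cases "j < d")
    case False
    then have "u j = (\<lambda>_. 0)" by (auto simp: u_def)
    then show ?thesis using zero by simp
  qed simp
  define U where "U = (\<lambda>k e. dft w N (\<lambda>j. u j e) k)"
  have 2: "computes (?S \<union> u ` {..<d}) (2 * m * N) (U ` {..<N})"
    unfolding U_def N_def using root w(1) u by (intro computes_dft) (auto simp: N_def)
  define V where "V = (\<lambda>k e. C k e * U k e)"
  have 3: "computes (?S \<union> U ` {..<N}) (N * 1) (V ` {..<N})"
    unfolding V_def using filter by (intro computes_family computes_mult) auto
  define Y where "Y = (\<lambda>i e. dft (inverse w) N (\<lambda>k. V k e) i)"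
  have 4: "computes (?S \<union> V ` {..<N}) (2 * m * N) (Y ` {..<N})"
    unfolding Y_def N_def using inv_root w(1)
    by (intro computes_dft) (auto simp: N_def power_inverse)
  have Y: "Y i = (\<lambda>e. complex_of_real (y i e))" if i: "i < d" for i
  proof
    fix e :: "(nat \<Rightarrow> real) \<times> (nat \<Rightarrow> real) \<times> (nat \<Rightarrow> real)"
    obtain r \<delta> x where e: "e = (r, \<delta>, x)" by (metis prod_cases3)
    have iN: "i < N" using i dN by linarith
    have "Y i e = (\<Sum>j<N. complex_of_real (unroll d N r ((i + N - j) mod N)) * u j e)"
      using dft_convolution[OF w iN] by (simp add: Y_def V_def C_def U_def e)
    \<comment> \<open>The zero padding of \<open>u\<close> removes all terms with
      \<open>j \<ge> d\<close>.\<close>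
    also have "\<dots> = (\<Sum>j<d. complex_of_real (unroll d N r ((i + N - j) mod N)) * u j e)"
      using dN by (intro sum.mono_neutral_right) (auto simp: u_def e)
    also have "\<dots> = complex_of_real (y i e)"
      using i by (simp add: y_def e u_def unroll_cyclic_index[OF dN])
    finally show "Y i e = complex_of_real (y i e)" .
  qed
  have program: "\<exists>P. cost P \<le> 4 * m * N + N + 2 * d \<and>
      (\<forall>e. run cs P (ss e) (xs e) = Some (map (\<lambda>i. complex_of_real (bin_sign (y i e))) [0..<k]))"
    if k: "k \<le> d" for k
  proof -
    have "computes (?S \<union> Y ` {..<N}) (k * 1) ((\<lambda>i e. complex_of_real (bin_sign (y i e))) ` {..<k})"
    proof (intro computes_family computes_sign)
      fix i assume "i < k"
      then have "i < d" "i < N" using k dN by linarith+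
      then show "(\<lambda>e. complex_of_real (y i e)) \<in> ?S \<union> Y ` {..<N}"
        using Y by (metis UnI2 imageI lessThan_iff)
    qed
    \<comment> \<open>The stages cost \<open>d\<close> (signs), \<open>2 * m * N\<close>
      (transform), \<open>N\<close> (pointwise product), \<open>2 * m * N\<close> (inverse
      transform) and \<open>k \<le> d\<close> (output signs).\<close>
    from computes_trans[OF computes_trans[OF computes_trans[OF computes_trans[OF 1 2] 3] 4] this]
    have "computes ?S (4 * m * N + N + 2 * d)
        ((\<lambda>i e. complex_of_real (bin_sign (y i e))) ` {..<k})"
      by (rule computes_mono) (use k in auto)
    then show ?thesis by (rule computes_program)
  qed
  show ?thesis
  proof (intro exI[of _ cs] allI impI)
    fix k assume "k \<le> d"
    from program[OF this] obtain P where P: "cost P \<le> 4 * m * N + N + 2 * d"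
      "\<And>e. run cs P (ss e) (xs e) = Some (map (\<lambda>i. complex_of_real (bin_sign (y i e))) [0..<k])"
      by blast
    have "\<exists>store. length store = d + 2 ^ m \<and>
      (\<forall>x. run cs P store (map (\<lambda>i. complex_of_real (x i)) [0..<d]) =
        Some (map (\<lambda>i. complex_of_real (bin_sign
          (\<Sum>j<d. r (nat ((int i - int j) mod int d)) * (\<delta> j * x j)))) [0..<k]))"
      for r \<delta> :: "nat \<Rightarrow> real"
    proof (intro exI[of _ "stored r \<delta>"] conjI allI)
      show "length (stored r \<delta>) = d + 2 ^ m" by (simp add: stored_def N_def)
      show "run cs P (stored r \<delta>) (map (\<lambda>i. complex_of_real (x i)) [0..<d]) =
        Some (map (\<lambda>i. complex_of_real (bin_sign
          (\<Sum>j<d. r (nat ((int i - int j) mod int d)) * (\<delta> j * x j)))) [0..<k])" for x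
        using P(2)[of "(r, \<delta>, x)"] by (simp add: ss_def xs_def y_def)
    qed
    with P(1) show "\<exists>P. cost P \<le> 4 * m * 2 ^ m + 2 ^ m + 2 * d \<and>
      (\<forall>r \<delta>. \<exists>store. length store = d + 2 ^ m \<and>
        (\<forall>x. run cs P store (map (\<lambda>i. complex_of_real (x i)) [0..<d]) =
          Some (map (\<lambda>i. complex_of_real (bin_sign
            (\<Sum>j<d. r (nat ((int i - int j) mod int d)) * (\<delta> j * x j)))) [0..<k])))"
      by (intro exI[of _ P]) (simp add: N_def)
  qed
qed

lemma complex_list_cbe_bits:
  assumes "r \<in> carrier_vec d" "sign_diagonal d D" "x \<in> carrier_vec d" "k \<le> d"
  shows "complex_list (cbe_bits k r D x) =
    map (\<lambda>i. complex_of_real (bin_sign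
      (\<Sum>j<d. r $ nat ((int i - int j) mod int d) * (D $$ (j, j) * x $ j)))) [0..<k]"
proof -
  have "cbe_bits k r D x $ i = bin_sign
      (\<Sum>j<d. r $ nat ((int i - int j) mod int d) * (D $$ (j, j) * x $ j))" if "i < k" for i
    using that assms circ_diagonal_mult_vec[OF assms(1-3), of i]
    by (simp add: cbe_bits_def cbe_def vec_first_def circ_def)
  moreover have "dim_vec (cbe_bits k r D x) = k" by (simp add: cbe_bits_def)
  ultimately show ?thesis by (simp add: complex_list_def list_of_vec_map)
qed

section \<open>Numerical bounds and the choice of the transform length\<close>

lemma operation_count_bound:
  assumes d: "d \<ge> 2" and n: "2 ^ n \<le> d"
  shows "real (4 * (n + 2) * 2 ^ (n + 2) + 2 ^ (n + 2) + 2 * d) \<le> 100 * real d * log 2 (real d)"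
proof -
  define L where "L = log 2 (real d)"
  define q :: real where "q = 2 ^ (n + 2)"
  have nL: "real n \<le> L"
    using n d by (simp add: L_def le_log_iff powr_realpow flip: of_nat_le_iff)
  have L1: "1 \<le> L" using d by (simp add: L_def le_log_iff)
  have q: "q \<le> 4 * real d" using n by (simp add: q_def flip: of_nat_le_iff)
  \<comment> \<open>Here \<open>n + 2 \<le> 3 * L\<close> follows from \<open>n \<le> L\<close> and
    \<open>1 \<le> L\<close>. This term contributes 48, the others at most 4 and 2, so 100 is a
    generous round constant.\<close>
  have "4 * (real n + 2) * q \<le> 4 * (3 * L) * (4 * real d)"
    using nL L1 q by (intro mult_mono) (auto simp: q_def)
  moreover have "real d \<le> real d * L" using L1 d by simp
  ultimately have "4 * (real n + 2) * q + q + 2 * real d \<le> 100 * (real d * L)"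
    using q by (simp add: algebra_simps)
  then show ?thesis by (simp add: L_def q_def algebra_simps)
qed

theorem proposition1:
  shows "\<exists>C::real. C > 0 \<and>
    (\<forall>d::nat. d \<ge> 2 \<longrightarrow>
      (\<exists>consts :: complex list. \<forall>k::nat. 1 \<le> k \<and> k \<le> d \<longrightarrow>
        (\<exists>alg :: program.
          real (cost alg) \<le> C * real d * log 2 (real d) \<and>
          (\<forall>(r :: real vec) (D :: real mat).
            r \<in> carrier_vec d \<and> sign_diagonal d D \<longrightarrow>
            (\<exists>store :: complex list.
              real (length store) \<le> C * real d \<and>
              (\<forall>x :: real vec. x \<in> carrier_vec d \<longrightarrow>
                run consts alg store (complex_list x)
                  = Some (complex_list (cbe_bits k r D x))))))))"
proof (intro exI[of _ "100 :: real"] conjI allI impI)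
  fix d :: nat
  assume d: "d \<ge> 2"
  \<comment> \<open>With \<open>n\<close> the integer part of the binary logarithm of
    \<open>d\<close>, the length \<open>N = 2 ^ (n + 2)\<close> satisfies
    \<open>2 * d \<le> N \<le> 4 * d\<close>.\<close>
  obtain n where n: "2 ^ n \<le> d" "d < 2 ^ (n + 1)"
    using ex_power_ivl1[of 2 d] d by auto
  have "2 * d \<le> 2 ^ (n + 2)" using n(2) by simp
  from circulant_program_exists[OF this] obtain cs where
    cs: "\<forall>k\<le>d. \<exists>P. cost P \<le> 4 * (n + 2) * 2 ^ (n + 2) + 2 ^ (n + 2) + 2 * d \<and>
    (\<forall>(r :: nat \<Rightarrow> real) \<delta>. \<exists>store. length store = d + 2 ^ (n + 2) \<and>
      (\<forall>x. run cs P store (map (\<lambda>i. complex_of_real (x i)) [0..<d]) =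
        Some (map (\<lambda>i. complex_of_real (bin_sign
          (\<Sum>j<d. r (nat ((int i - int j) mod int d)) * (\<delta> j * x j)))) [0..<k])))" ..
  show "\<exists>consts :: complex list. \<forall>k::nat. 1 \<le> k \<and> k \<le> d \<longrightarrow>
        (\<exists>alg :: program.
          real (cost alg) \<le> 100 * real d * log 2 (real d) \<and>
          (\<forall>(r :: real vec) (D :: real mat).
            r \<in> carrier_vec d \<and> sign_diagonal d D \<longrightarrow>
            (\<exists>store :: complex list.
              real (length store) \<le> 100 * real d \<and>
              (\<forall>x :: real vec. x \<in> carrier_vec d \<longrightarrow>
                run consts alg store (complex_list x)
                  = Some (complex_list (cbe_bits k r D x))))))"
  proof (intro exI[of _ cs] allI impI)
    fix k assume k: "1 \<le> k \<and> k \<le> d"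
    with cs obtain P where
      P: "cost P \<le> 4 * (n + 2) * 2 ^ (n + 2) + 2 ^ (n + 2) + 2 * d" and
      store: "\<And>(r :: nat \<Rightarrow> real) \<delta>. \<exists>store. length store = d + 2 ^ (n + 2) \<and>
      (\<forall>x. run cs P store (map (\<lambda>i. complex_of_real (x i)) [0..<d]) =
        Some (map (\<lambda>i. complex_of_real (bin_sign
          (\<Sum>j<d. r (nat ((int i - int j) mod int d)) * (\<delta> j * x j)))) [0..<k]))"
      by meson
    have "real (cost P) \<le> 100 * real d * log 2 (real d)"
      using P operation_count_bound[OF d n(1)] by (meson of_nat_mono order_trans)
    moreover have "\<exists>store :: complex list. real (length store) \<le> 100 * real d \<and>
        (\<forall>x :: real vec. x \<in> carrier_vec d \<longrightarrow>
          run cs P store (complex_list x) = Some (complex_list (cbe_bits k r D x)))"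
      if rD: "r \<in> carrier_vec d \<and> sign_diagonal d D" for r D
    proof -
      obtain st where st: "length st = d + 2 ^ (n + 2)"
        "\<And>x. run cs P st (map (\<lambda>i. complex_of_real (x i)) [0..<d]) =
          Some (map (\<lambda>i. complex_of_real (bin_sign
            (\<Sum>j<d. r $ (nat ((int i - int j) mod int d)) * (D $$ (j, j) * x j)))) [0..<k])"
        using store[of "($) r" "\<lambda>j. D $$ (j, j)"] by blast
      \<comment> \<open>In fact \<open>d + 2 ^ (n + 2)\<close> is at most \<open>5 * d\<close>; the
        constant 100 is shared with the time bound.\<close>
      have "length st \<le> 100 * d" using st(1) n(1) by simp
      then have "real (length st) \<le> 100 * real d" by (simp flip: of_nat_le_iff)
      moreover have "run cs P st (complex_list x) = Some (complex_list (cbe_bits k r D x))"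
        if x: "x \<in> carrier_vec d" for x
      proof -
        have "complex_list x = map (\<lambda>i. complex_of_real (x $ i)) [0..<d]"
          using x by (simp add: complex_list_def list_of_vec_map)
        then show ?thesis using st(2)[of "($) x"] complex_list_cbe_bits[of r d D x k] rD x k
          by simp
      qed
      ultimately show ?thesis by blast
    qed
    ultimately show "\<exists>alg :: program.
          real (cost alg) \<le> 100 * real d * log 2 (real d) \<and>
          (\<forall>(r :: real vec) (D :: real mat).
            r \<in> carrier_vec d \<and> sign_diagonal d D \<longrightarrow>
            (\<exists>store :: complex list.
              real (length store) \<le> 100 * real d \<and>
              (\<forall>x :: real vec. x \<in> carrier_vec d \<longrightarrow>
                run cs alg store (complex_list x)
                  = Some (complex_list (cbe_bits k r D x)))))"
      by blast
  qed
qed simp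

end
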